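(* Let $G=(V,E)$ be a finite strongly connected digraph with at least one edge (loops and multiple edges allowed), and for each vertex fix an arbitrary cyclic ordering of the edges emanating from it. For $v\in V$ let $\deg_G^{+}(v)$ be the outdegree of $v$, let $\mathcal{T}_G(v)$ be the number of oriented spanning trees of $G$ rooted at $v$, and let $M$ be the greatest common divisor of the numbers in $\{\mathcal{T}_G(v): v\in V\}$. Then for every recurrent state $c$ of $G$, the size of the orbit of $c$ under the rotor-router operation is $$\frac{1}{M}\sum_{v\in V}\deg_G^{+}(v)\,\mathcal{T}_G(v).$$ Consequently, the number of distinct orbits of recurrent states of $G$ is $M$.
   Context: Digraphs may have loops and multi-edges (parallel edges are distinct edges); the outdegree $\deg_G^{+}(v)$ counts all edges with tail $v$, including loops. An oriented spanning tree of $G$ rooted at $s\in V$ is a spanning subgraph $T$ (identified with its edge set) such that $s$ has outdegree $0$ in $T$ and every vertex $v$ has a unique path in $T$ to $s$. Rotor-router operation: for each vertex $v$ the set of edges emanating from $v$ is equipped with a cyclic ordering, and $e^{+}$ denotes the edge following $e$ in the cyclic ordering at the tail of $e$. A sink is a vertex of outdegree $0$; here $G$ has no sink. A rotor configuration is a map $\rho:V\to E$ such that $\rho(v)$ is an edge emanating from $v$ for each $v$. A (single-chip-and-rotor) state is a pair $(v,\rho)$ with $v\in V$ (the location of the chip) and $\rho$ a rotor configuration. The rotor-router operation sends $(v,\rho)$ to $(v',\rho')$, where $\rho'(v)=\rho(v)^{+}$, $\rho'(u)=\rho(u)$ for $u\ne v$, and $v'$ is the head of $\rho'(v)$. A state is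 recurrent if iterating the rotor-router operation a positive number of times starting from it gives the same state again. The orbit of a recurrent state is the set of all states reachable from it by iterating the rotor-router operation. *)

theory Defs
  imports
    Complex_Main
    "HOL-Library.FuncSet"
    "HOL-Combinatorics.Orbits"
    "Graph_Theory.Digraph_Component"
begin

text \<open>
  An oriented spanning tree is given by its arc set \<open>T\<close>. The unique path from a vertex to the
  root is an arc walk (\<open>awalk\<close>), not a vertex-simple \<open>apath\<close>: uniqueness among simple paths
  would not exclude directed cycles. For instance, with arcs \<open>v \<rightarrow> s\<close>, \<open>v \<rightarrow> w\<close>, \<open>w \<rightarrow> v\<close> (or
  with a loop at \<open>v\<close> added to a tree) simple paths to \<open>s\<close> are unique, but the arcs do not form
  a tree. The unique walk is automatically vertex-simple.
\<close>

definition oriented_spanning_tree :: "('a, 'b) pre_digraph \<Rightarrow> 'a \<Rightarrow> 'b set \<Rightarrow> bool" where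
  "oriented_spanning_tree G s T \<longleftrightarrow>
     s \<in> verts G \<and>
     spanning (G\<lparr>arcs := T\<rparr>) G \<and>
     out_degree (G\<lparr>arcs := T\<rparr>) s = 0 \<and>
     (\<forall>v\<in>verts G. \<exists>!p. pre_digraph.awalk (G\<lparr>arcs := T\<rparr>) v p s)"

definition tree_count :: "('a, 'b) pre_digraph \<Rightarrow> 'a \<Rightarrow> nat" where
  "tree_count G s = card {T. oriented_spanning_tree G s T}"

text \<open>
  A cyclic ordering of a finite nonempty set is given by its successor function, which permutes
  the set in a single cycle. The out-arc sets of distinct vertices are disjoint, so one function
  \<open>nxt\<close> on arcs encodes the cyclic orderings at all vertices.
\<close>

definition cyclic_orderings :: "('a, 'b) pre_digraph \<Rightarrow> ('b \<Rightarrow> 'b) \<Rightarrow> bool" where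
  "cyclic_orderings G nxt \<longleftrightarrow>
     (\<forall>v\<in>verts G. out_arcs G v \<noteq> {} \<longrightarrow> cyclic_on nxt (out_arcs G v))"

text \<open>
  Rotor configurations are extensional functions (\<open>undefined\<close> outside the vertex set), so that
  equality of configurations means agreement on all vertices.
\<close>

definition rotor_configs :: "('a, 'b) pre_digraph \<Rightarrow> ('a \<Rightarrow> 'b) set" where
  "rotor_configs G = (\<Pi>\<^sub>E v\<in>verts G. out_arcs G v)"

definition rotor_states :: "('a, 'b) pre_digraph \<Rightarrow> ('a \<times> ('a \<Rightarrow> 'b)) set" where
  "rotor_states G = verts G \<times> rotor_configs G"

fun rotor_step ::
  "('a, 'b) pre_digraph \<Rightarrow> ('b \<Rightarrow> 'b) \<Rightarrow> 'a \<times> ('a \<Rightarrow> 'b) \<Rightarrow> 'a \<times> ('a \<Rightarrow> 'b)" where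
  "rotor_step G nxt (v, \<rho>) = (let \<rho>' = \<rho>(v := nxt (\<rho> v)) in (head G (\<rho>' v), \<rho>'))"

definition recurrent_states ::
  "('a, 'b) pre_digraph \<Rightarrow> ('b \<Rightarrow> 'b) \<Rightarrow> ('a \<times> ('a \<Rightarrow> 'b)) set" where
  "recurrent_states G nxt =
     {c \<in> rotor_states G. \<exists>n>0. (rotor_step G nxt ^^ n) c = c}"

text \<open>
  The library's \<open>orbit f c\<close> collects \<open>(f ^^ n) c\<close> for \<open>n > 0\<close>. For a recurrent state \<open>c\<close> this
  contains \<open>c\<close> itself, so it is the set of all states reachable from \<open>c\<close>.
\<close>

definition rotor_orbit ::
  "('a, 'b) pre_digraph \<Rightarrow> ('b \<Rightarrow> 'b) \<Rightarrow> 'a \<times> ('a \<Rightarrow> 'b) \<Rightarrow> ('a \<times> ('a \<Rightarrow> 'b)) set" where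
  "rotor_orbit G nxt c = orbit (rotor_step G nxt) c"

end

theory Submission
  imports Defs
begin

text \<open>
  A unicycle is a state \<open>(v, \<rho>)\<close> in which following the rotors leads from every vertex to the
  chip. Erasing the rotor at \<open>v\<close> leaves an oriented spanning tree rooted at \<open>v\<close>, and any arc out
  of \<open>v\<close> may be put back, so exactly \<open>tree_count G (tail G e)\<close> unicycles have the arc \<open>e\<close> as the
  rotor under the chip (\<open>card_unicycles_rotor\<close>). Hence there are \<open>\<Sum>v. deg v * tree_count v\<close>
  unicycles in all (\<open>card_unicycles\<close>).

  Moving the chip along its rotor without turning any rotor is a permutation of the unicycles. A
  unicycle with chip at \<open>v\<close> arises in this way from one whose rotor under the chip is an arc into
  \<open>v\<close>. Counting the unicycles with chip at \<open>v\<close> directly and through this permutation gives the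
  identity \<open>deg v * tree_count v = (\<Sum>e into v. tree_count (tail e))\<close> (\<open>tree_count_balanced\<close>),
  which is the Markov chain tree theorem. It survives division of the tree counts by their greatest
  common divisor \<open>M\<close>.

  The key step is \<open>unicycle_return\<close>. If \<open>m\<close> is any natural-valued solution of these balance
  equations, then the rotor walk from a unicycle is back at its start after exactly
  \<open>\<Sum>v. deg v * m v\<close> steps, in which each vertex \<open>v\<close> has fired \<open>deg v * m v\<close> times. One stops the
  walk as soon as the chip stands on a vertex that has exhausted its budget \<open>deg v * m v\<close>.
  Conservation of the chip shows that this vertex is the starting point and that all arcs into it
  have been used up. Exhaustion then propagates backwards along the initial rotors, which lead from
  every vertex to the start.

  With \<open>m = tree_count / M\<close> the period \<open>p\<close> of a unicycle divides \<open>N = \<Sum>v. deg v * tree_count v / M\<close>.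
  Within one period each vertex turns its rotor around completely, a whole number of times, so
  \<open>N / p\<close> divides every \<open>tree_count v / M\<close>. These numbers have greatest common divisor 1, and so
  \<open>p = N\<close> (\<open>card_rotor_orbit\<close>). Every orbit thus has \<open>1 / M\<close> times as many elements as there are
  unicycles, and the orbits partition the unicycles into \<open>M\<close> parts.

  Unicycles are recurrent by \<open>unicycle_return\<close>. Conversely, a vertex once visited always leads to
  the current chip position along the rotors, and in a strongly connected digraph the periodic walk
  of a recurrent state visits every vertex; so the recurrent states are the unicycles.
\<close>

section \<open>Iterating a cyclic successor function\<close>

lemma cyclic_on_funpow_card:
  assumes "cyclic_on f S" "a \<in> S"
  shows "(f ^^ card S) a = a"
    and "bij_betw (\<lambda>i. (f ^^ i) a) {..<card S} S"
    and "(f ^^ n) a = a \<longleftrightarrow> card S dvd n"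
proof -
  have S: "orbit f a = S"
    using assms by (simp add: orbit_cyclic_eq3)
  then have self: "a \<in> orbit f a"
    using assms(2) by simp
  define p where "p = funpow_dist1 f a a"
  have p: "p > 0" "(f ^^ p) a = a"
    using funpow_dist1_prop[OF self] by (simp_all add: p_def)
  have least: "(f ^^ i) a \<noteq> a" if "0 < i" "i < p" for i
    using funpow_dist1_least[of i f a a] that by (simp add: p_def)
  have red: "(f ^^ n) a = (f ^^ (n mod p)) a"
    using p(2) by (metis funpow_mod_eq)
  have inj: "inj_on (\<lambda>i. (f ^^ i) a) {..<p}"
    using inj_on_funpow_dist1[OF self] by (simp add: p_def atLeast0LessThan)
  have im: "(\<lambda>i. (f ^^ i) a) ` {..<p} = S"
    using orbit_conv_funpow_dist1[OF self] S by (simp add: p_def atLeast0LessThan)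
  have card: "card S = p"
    using card_image[OF inj] im by simp
  show "(f ^^ card S) a = a"
    using p card by simp
  show "bij_betw (\<lambda>i. (f ^^ i) a) {..<card S} S"
    using inj im card by (simp add: bij_betw_def)
  show "(f ^^ n) a = a \<longleftrightarrow> card S dvd n"
    using least[of "n mod p"] red p(1) card
    by (metis dvd_eq_mod_eq_0 funpow_0 gr0I mod_less_divisor)
qed

definition visits :: "('b \<Rightarrow> 'b) \<Rightarrow> 'b \<Rightarrow> 'b \<Rightarrow> nat \<Rightarrow> nat" where
  "visits f a e n = (\<Sum>i<n. of_bool ((f ^^ Suc i) a = e))"

lemma visits_simps [simp]:
  "visits f a e 0 = 0"
  "visits f a e (Suc n) = visits f a e n + of_bool ((f ^^ Suc n) a = e)"
  by (simp_all add: visits_def)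

lemma visits_mono: "m \<le> n \<Longrightarrow> visits f a e m \<le> visits f a e n"
  unfolding visits_def by (rule sum_mono2) auto

lemma visits_add: "visits f a e (m + n) = visits f a e m + visits f ((f ^^ m) a) e n"
proof -
  have "(f ^^ n) ((f ^^ m) a) = (f ^^ (m + n)) a" for n
    by (metis add.commute comp_apply funpow_add)
  then show ?thesis
    by (induction n) simp_all
qed

text \<open>
  Each full turn, of \<open>card S\<close> iterations, passes through every element of \<open>S\<close> exactly once.
\<close>

lemma visits_full_turns:
  assumes "cyclic_on f S" "a \<in> S" "e \<in> S"
  shows "visits f a e (card S * m) = m"
proof (induction m)
  case (Suc m)
  have fa: "f a \<in> S"
    using assms cyclic_on_inI by metis
  have "visits f a e (card S) = (\<Sum>i<card S. of_bool ((f ^^ i) (f a) = e))"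
    by (simp add: visits_def funpow_swap1)
  also have "\<dots> = (\<Sum>x\<in>S. of_bool (x = e))"
    using cyclic_on_funpow_card(2)[OF assms(1) fa] by (rule sum.reindex_bij_betw)
  also have "\<dots> = 1"
    using assms finite_cyclic_on[OF assms(1)] by (simp add: of_bool_def)
  finally have "visits f a e (card S) = 1" .
  moreover have "(f ^^ (card S * m)) a = a"
    using cyclic_on_funpow_card(3)[OF assms(1,2)] by simp
  ultimately show ?case
    using Suc by (simp add: visits_add add.commute[of "card S"])
qed simp

lemma visits_le_turns:
  assumes "cyclic_on f S" "a \<in> S" "e \<in> S" "n \<le> card S * m"
  shows "visits f a e n \<le> m"
  using visits_mono[OF assms(4)] visits_full_turns[OF assms(1-3)] by metis

text \<open>
  The last iterate of \<open>m\<close> full turns is \<open>a\<close> itself, so stopping earlier would miss its \<open>m\<close>-th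
  visit. For any other element of the cycle, the \<open>m\<close>-th visit comes before the end of the last turn.
\<close>

lemma visits_own_full:
  assumes "cyclic_on f S" "a \<in> S" "n \<le> card S * m" "visits f a a n = m"
  shows "n = card S * m"
proof (rule ccontr)
  assume "n \<noteq> card S * m"
  then obtain k where k: "card S * m = Suc k" "n \<le> k"
    using assms(3) by (cases "card S * m") auto
  have "(f ^^ Suc k) a = a"
    using cyclic_on_funpow_card(3)[OF assms(1,2), of "Suc k"] k(1) by (metis dvd_triv_left)
  then have "m = Suc (visits f a a k)"
    using visits_full_turns[OF assms(1,2,2), of m] k(1) by simp
  with visits_mono[OF k(2), of f a a] assms(4) show False by simp
qed

section \<open>Unicycles\<close>

locale rotor_digraph = fin_digraph G for G :: "('a, 'b) pre_digraph" (structure) +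
  fixes nxt :: "'b \<Rightarrow> 'b"
  assumes cyclic: "v \<in> verts G \<Longrightarrow> cyclic_on nxt (out_arcs G v)"
begin

lemma no_sink: "v \<in> verts G \<Longrightarrow> out_arcs G v \<noteq> {}"
  using cyclic by (auto simp: cyclic_on_def)

abbreviation "step \<equiv> rotor_step G nxt"

definition follow :: "('a \<Rightarrow> 'b) \<Rightarrow> 'a \<Rightarrow> 'a" where
  "follow \<rho> u = head G (\<rho> u)"

definition reaches :: "('a \<Rightarrow> 'b) \<Rightarrow> 'a \<Rightarrow> 'a \<Rightarrow> bool" where
  "reaches \<rho> u v \<longleftrightarrow> (\<exists>n. (follow \<rho> ^^ n) u = v)"

text \<open>
  A functional graph in which every vertex leads to \<open>v\<close> has a single directed cycle, and \<open>v\<close> lies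
  on it.
\<close>

definition unicycles :: "('a \<times> ('a \<Rightarrow> 'b)) set" where
  "unicycles = {(v, \<rho>) \<in> rotor_states G. \<forall>u\<in>verts G. reaches \<rho> u v}"

lemma reaches_refl [simp]: "reaches \<rho> v v"
  unfolding reaches_def by (rule exI[of _ 0]) simp

lemma reaches_trans: "reaches \<rho> u v \<Longrightarrow> reaches \<rho> v w \<Longrightarrow> reaches \<rho> u w"
  unfolding reaches_def by (metis comp_apply funpow_add)

lemma reaches_follow [simp]: "reaches \<rho> v (follow \<rho> v)"
  unfolding reaches_def by (rule exI[of _ 1]) simp

text \<open>
  The walk to \<open>v\<close> can be cut off at its first arrival there, and until then it does not consult the
  rotor at \<open>v\<close>.
\<close>

lemma reaches_upd:
  assumes "reaches \<rho> u v"
  shows "reaches (\<rho>(v := e)) u v"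
proof -
  obtain n where "(follow \<rho> ^^ n) u = v"
    using assms by (auto simp: reaches_def)
  then show ?thesis
  proof (induction n arbitrary: u)
    case (Suc n)
    then have IH: "reaches (\<rho>(v := e)) (follow \<rho> u) v"
      by (simp add: funpow_swap1 del: fun_upd_apply)
    show ?case
    proof (cases "u = v")
      case False
      then have "follow (\<rho>(v := e)) u = follow \<rho> u"
        by (simp add: follow_def)
      with IH show ?thesis
        by (metis reaches_follow reaches_trans)
    qed simp
  qed simp
qed

text \<open>
  The rotor-router operation turns the rotor under the chip and then moves the chip along it. The
  second half is singled out because it permutes the unicycles without changing any rotor, so that
  it can be counted through by looking at the arc that the chip crosses.
\<close>

definition rotate :: "'a \<times> ('a \<Rightarrow> 'b) \<Rightarrow> 'a \<times> ('a \<Rightarrow> 'b)" where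
  "rotate = (\<lambda>(v, \<rho>). (v, \<rho>(v := nxt (\<rho> v))))"

definition advance :: "'a \<times> ('a \<Rightarrow> 'b) \<Rightarrow> 'a \<times> ('a \<Rightarrow> 'b)" where
  "advance = (\<lambda>(v, \<rho>). (follow \<rho> v, \<rho>))"

lemma step_eq: "step = advance \<circ> rotate"
  by (auto simp: fun_eq_iff advance_def rotate_def follow_def Let_def)

lemma rotor_configs_out_arcs:
  "\<rho> \<in> rotor_configs G \<Longrightarrow> v \<in> verts G \<Longrightarrow> \<rho> v \<in> out_arcs G v"
  by (auto simp: rotor_configs_def)

lemma follow_in_verts:
  "\<rho> \<in> rotor_configs G \<Longrightarrow> v \<in> verts G \<Longrightarrow> follow \<rho> v \<in> verts G"
  using rotor_configs_out_arcs by (fastforce simp: follow_def out_arcs_def)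

lemma rotor_configs_upd:
  assumes "\<rho> \<in> rotor_configs G" "v \<in> verts G" "e \<in> out_arcs G v"
  shows "\<rho>(v := e) \<in> rotor_configs G"
  using assms unfolding rotor_configs_def by (auto simp: PiE_iff extensional_def)

lemma nxt_out_arcs: "v \<in> verts G \<Longrightarrow> e \<in> out_arcs G v \<Longrightarrow> nxt e \<in> out_arcs G v"
  using cyclic cyclic_on_inI by metis

lemma rotate_state: "c \<in> rotor_states G \<Longrightarrow> rotate c \<in> rotor_states G"
proof -
  assume c: "c \<in> rotor_states G"
  obtain v \<rho> where v\<rho>: "c = (v, \<rho>)" "v \<in> verts G" "\<rho> \<in> rotor_configs G"
    using c by (auto simp: rotor_states_def)
  then have "\<rho>(v := nxt (\<rho> v)) \<in> rotor_configs G"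
    by (intro rotor_configs_upd nxt_out_arcs rotor_configs_out_arcs)
  with v\<rho> show ?thesis
    by (simp add: rotate_def rotor_states_def)
qed

lemma advance_state: "c \<in> rotor_states G \<Longrightarrow> advance c \<in> rotor_states G"
  by (auto simp: rotor_states_def advance_def intro: follow_in_verts)

lemma step_state: "c \<in> rotor_states G \<Longrightarrow> step c \<in> rotor_states G"
  by (simp add: step_eq rotate_state advance_state)

lemma funpow_step_state: "c \<in> rotor_states G \<Longrightarrow> (step ^^ n) c \<in> rotor_states G"
  by (induction n) (auto simp: step_state simp del: rotor_step.simps)

lemma rotate_unicycle: "c \<in> unicycles \<Longrightarrow> rotate c \<in> unicycles"
  using rotate_state[of c] by (auto simp: unicycles_def rotate_def intro: reaches_upd)

lemma advance_unicycle: "c \<in> unicycles \<Longrightarrow> advance c \<in> unicycles"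
  using advance_state[of c]
  by (auto simp: unicycles_def advance_def intro: reaches_trans reaches_follow)

text \<open>
  If the chip may have come to \<open>x\<close> from \<open>v\<close> or from \<open>w\<close>, then both precede \<open>x\<close> on the directed
  cycle through \<open>x\<close>, and the predecessor on a cycle is unique.
\<close>

lemma inj_advance: "inj_on advance unicycles"
proof (rule inj_onI)
  fix c d assume c: "c \<in> unicycles" and d: "d \<in> unicycles" and eq: "advance c = advance d"
  obtain v w \<rho> where cd: "c = (v, \<rho>)" "d = (w, \<rho>)"
    using eq by (cases c; cases d) (auto simp: advance_def)
  define f x where "f = follow \<rho>" and "x = f v"
  have x: "f v = x" "f w = x"
    using eq cd by (auto simp: advance_def f_def x_def)
  have "x \<in> verts G"
    using c cd follow_in_verts by (auto simp: unicycles_def rotor_states_def x_def f_def)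
  then have "reaches \<rho> x v" "reaches \<rho> x w"
    using c d cd by (auto simp: unicycles_def)
  then obtain a b where ab: "(f ^^ a) x = v" "(f ^^ b) x = w"
    by (auto simp: reaches_def f_def)
  then have per: "(f ^^ Suc a) x = x" "(f ^^ Suc b) x = x"
    using x by auto
  have mult: "(f ^^ (k * n)) x = x" if "(f ^^ n) x = x" for k n
    using that by (induction k) (simp_all add: funpow_add)
  \<comment> \<open>Both \<open>v\<close> and \<open>w\<close> are reached from \<open>x\<close> in \<open>Suc a * Suc b - 1\<close> steps.\<close>
  have "v = (f ^^ (a + b * Suc a)) x"
    using mult[OF per(1), of b] ab by (simp only: funpow_add comp_apply)
  also have "a + b * Suc a = b + a * Suc b"
    by simp
  also have "(f ^^ (b + a * Suc b)) x = w"
    using mult[OF per(2), of a] ab by (simp only: funpow_add comp_apply)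
  finally show "c = d"
    using cd by simp
qed

lemma unicycles_subset: "unicycles \<subseteq> rotor_states G"
  by (auto simp: unicycles_def)

lemma finite_unicycles: "finite unicycles"
proof -
  have "finite (rotor_states G)"
    unfolding rotor_states_def rotor_configs_def
    by (intro finite_cartesian_product finite_PiE finite_verts finite_out_arcs)
  then show ?thesis
    using unicycles_subset finite_subset by blast
qed

lemma bij_advance: "bij_betw advance unicycles unicycles"
  using inj_advance advance_unicycle finite_unicycles
  by (simp add: bij_betw_def endo_inj_surj image_subsetI)

section \<open>Counting unicycles by spanning trees\<close>

text \<open>
  Existence of walks to \<open>v\<close> is the defining property of a unicycle. They are unique because each
  vertex other than \<open>v\<close> has just one outgoing arc in the tree, and \<open>v\<close> has none.
\<close>

lemma unicycle_tree:
  assumes U: "(v, \<rho>) \<in> unicycles"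
  shows "oriented_spanning_tree G v (\<rho> ` (verts G - {v}))"
proof -
  define T where "T = \<rho> ` (verts G - {v})"
  define H where "H = G\<lparr>arcs := T\<rparr>"
  have v: "v \<in> verts G" and \<rho>: "\<rho> \<in> rotor_configs G"
    and reach: "\<And>u. u \<in> verts G \<Longrightarrow> reaches \<rho> u v"
    using U by (auto simp: unicycles_def rotor_states_def)
  have H [simp]: "verts H = verts G" "arcs H = T" "tail H = tail G" "head H = head G"
    by (simp_all add: H_def)
  have T: "e \<in> T \<longleftrightarrow> e \<in> arcs G \<and> tail G e \<noteq> v \<and> e = \<rho> (tail G e)" for e
    using rotor_configs_out_arcs[OF \<rho>] by (fastforce simp: T_def out_arcs_def)
  interpret H: wf_digraph H
    by unfold_locales (auto simp: T)
  have "subgraph H G"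
    using H.wf_digraph_axioms wf_digraph_axioms by (auto simp: subgraph_def compatible_def T)
  then have spanning: "spanning H G"
    by (simp add: spanning_def)
  have root: "out_degree H v = 0"
  proof -
    have "out_arcs H v = {}"
      by (auto simp: out_arcs_def T)
    then show ?thesis
      by (simp add: out_degree_def)
  qed
  have ex: "\<exists>p. H.awalk u p v" if u: "u \<in> verts G" for u
  proof -
    obtain n where "(follow \<rho> ^^ n) u = v"
      using reach[OF u] by (auto simp: reaches_def)
    then show ?thesis
      using u
    proof (induction n arbitrary: u)
      case 0
      then show ?case
        using H.awalk_Nil_iff by auto
    next
      case (Suc n)
      show ?case
      proof (cases "u = v")
        case True
        then show ?thesis
          using Suc.prems(2) H.awalk_Nil_iff by auto
      next
        case False
        obtain p where "H.awalk (follow \<rho> u) p v"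
          using Suc.IH[of "follow \<rho> u"] Suc.prems follow_in_verts[OF \<rho>]
          by (auto simp: funpow_swap1)
        moreover have "tail G (\<rho> u) = u" "\<rho> u \<in> arcs G"
          using rotor_configs_out_arcs[OF \<rho> Suc.prems(2)] by auto
        ultimately have "H.awalk u (\<rho> u # p) v"
          using False by (simp add: H.awalk_Cons_iff T follow_def)
        then show ?thesis ..
      qed
    qed
  qed
  have unique: "p = q" if "H.awalk u p v" "H.awalk u q v" for u p q
    using that
  proof (induction p arbitrary: u q)
    case Nil
    then show ?case
      by (cases q) (auto simp: H.awalk_Nil_iff H.awalk_Cons_iff T)
  next
    case (Cons e es)
    show ?case
    proof (cases q)
      case Nil
      then show ?thesis
        using Cons.prems by (auto simp: H.awalk_Nil_iff H.awalk_Cons_iff T)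
    next
      case q: (Cons e' es')
      have "e = \<rho> u" "e' = \<rho> u" "H.awalk (head G e) es v" "H.awalk (head G e') es' v"
        using Cons.prems q by (auto simp: H.awalk_Cons_iff T)
      then show ?thesis
        using Cons.IH q by simp
    qed
  qed
  show ?thesis
    unfolding oriented_spanning_tree_def T_def[symmetric] H_def[symmetric]
    using v spanning root by (intro conjI ballI ex_ex1I ex unique)
qed

text \<open>
  In a tree, two arcs out of the same vertex would start two different walks to the root. So the
  tree arcs define the rotors at all vertices but the root, where the given \<open>e\<close> is used.
\<close>

lemma tree_unicycle:
  assumes tree: "oriented_spanning_tree G v T" and e: "e \<in> out_arcs G v"
  obtains \<rho> where "(v, \<rho>) \<in> unicycles" "\<rho> v = e" "\<rho> ` (verts G - {v}) = T"
proof -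
  define H where "H = G\<lparr>arcs := T\<rparr>"
  have H [simp]: "verts H = verts G" "arcs H = T" "tail H = tail G" "head H = head G"
    by (simp_all add: H_def)
  have v: "v \<in> verts G" and spanning: "spanning H G" and root: "out_degree H v = 0"
    and walks: "\<And>u. u \<in> verts G \<Longrightarrow> \<exists>!p. pre_digraph.awalk H u p v"
    using tree by (auto simp: oriented_spanning_tree_def H_def)
  interpret H: wf_digraph H
    using spanning by (simp add: spanning_def subgraph_def)
  have walk_ex: "\<exists>p. H.awalk u p v" if "u \<in> verts G" for u
    using walks[OF that] by (rule ex1_implies_ex)
  have walk_unique: "p = q" if "H.awalk u p v" "H.awalk u q v" for u p q
  proof -
    have "u \<in> verts G"
      using H.awalk_hd_in_verts[OF that(1)] by simp
    from walks[OF this] that show ?thesis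
      by (metis (no_types))
  qed
  have TG: "T \<subseteq> arcs G"
    using spanning by (auto simp: spanning_def subgraph_def)
  then have "finite T"
    using finite_arcs by (rule finite_subset)
  then have no_out: "tail G a \<noteq> v" if "a \<in> T" for a
    using root that by (auto simp: out_degree_def out_arcs_def)
  have ex: "\<exists>a. a \<in> T \<and> tail G a = u" if u: "u \<in> verts G" "u \<noteq> v" for u
  proof -
    obtain p where "H.awalk u p v"
      using walk_ex[OF u(1)] ..
    then show ?thesis
      using u by (cases p) (auto simp: H.awalk_Nil_iff H.awalk_Cons_iff)
  qed
  have unique: "a = b" if "a \<in> T" "b \<in> T" "tail G a = tail G b" for a b
  proof -
    have heads: "tail G a \<in> verts G" "head G a \<in> verts G" "head G b \<in> verts G"
      using that TG by auto
    obtain p where p: "H.awalk (head G a) p v"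
      using walk_ex[OF heads(2)] ..
    obtain q where q: "H.awalk (head G b) q v"
      using walk_ex[OF heads(3)] ..
    from p q have "H.awalk (tail G a) (a # p) v" "H.awalk (tail G a) (b # q) v"
      using that by (simp_all add: H.awalk_Cons_iff)
    from walk_unique[OF this] show ?thesis
      by simp
  qed
  obtain next_arc where next_arc: "\<And>u. u \<in> verts G \<Longrightarrow> u \<noteq> v \<Longrightarrow> next_arc u \<in> T \<and> tail G (next_arc u) = u"
    using ex by metis
  define \<rho> where "\<rho> = (\<lambda>u\<in>verts G. if u = v then e else next_arc u)"
  have \<rho>: "\<rho> \<in> rotor_configs G"
    using e next_arc TG by (fastforce simp: rotor_configs_def \<rho>_def out_arcs_def)
  have \<rho>_eq: "\<rho> (tail G a) = a" if "a \<in> T" for a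
    using that TG no_out[OF that] unique next_arc by (auto simp: \<rho>_def)
  have reach: "reaches \<rho> u v" if u: "u \<in> verts G" for u
  proof -
    obtain p where "H.awalk u p v"
      using walk_ex[OF u] ..
    then show ?thesis
    proof (induction p arbitrary: u)
      case Nil
      then show ?case
        by (simp add: H.awalk_Nil_iff)
    next
      case (Cons a p)
      then have "a \<in> T" "u = tail G a" "reaches \<rho> (head G a) v"
        by (simp_all add: H.awalk_Cons_iff)
      then show ?case
        using \<rho>_eq reaches_follow[of \<rho> u] reaches_trans by (metis follow_def)
    qed
  qed
  have "\<rho> ` (verts G - {v}) = T"
  proof
    show "\<rho> ` (verts G - {v}) \<subseteq> T"
      using next_arc by (auto simp: \<rho>_def)
    show "T \<subseteq> \<rho> ` (verts G - {v})"
    proof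
      fix a assume "a \<in> T"
      then show "a \<in> \<rho> ` (verts G - {v})"
        using \<rho>_eq[of a] no_out[of a] TG by (intro image_eqI[of _ _ "tail G a"]) auto
    qed
  qed
  moreover have "(v, \<rho>) \<in> unicycles"
    using v \<rho> reach by (auto simp: unicycles_def rotor_states_def)
  moreover have "\<rho> v = e"
    using v by (simp add: \<rho>_def)
  ultimately show thesis
    using that by blast
qed

lemma unicycle_rotor:
  assumes "c \<in> unicycles"
  shows "snd c (fst c) \<in> arcs G" "tail G (snd c (fst c)) = fst c"
  using assms rotor_configs_out_arcs
  by (fastforce simp: unicycles_def rotor_states_def out_arcs_def)+

text \<open>
  A unicycle is determined by the tree formed by the rotors away from the chip, once the rotor under
  the chip is prescribed; the latter also fixes the position of the chip.
\<close>

lemma card_unicycles_rotor: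
  assumes e: "e \<in> arcs G"
  shows "card {c \<in> unicycles. snd c (fst c) = e} = tree_count G (tail G e)"
proof -
  define v where "v = tail G e"
  define A where "A = {c \<in> unicycles. snd c (fst c) = e}"
  have A: "fst c = v" "snd c v = e" "c \<in> unicycles" if "c \<in> A" for c
    using that unicycle_rotor[of c] by (auto simp: A_def v_def)
  have "bij_betw (\<lambda>c. snd c ` (verts G - {v})) A {T. oriented_spanning_tree G v T}"
  proof (rule bij_betw_imageI)
    show "inj_on (\<lambda>c. snd c ` (verts G - {v})) A"
    proof (rule inj_onI)
      fix c d assume c: "c \<in> A" and d: "d \<in> A"
        and eq: "snd c ` (verts G - {v}) = snd d ` (verts G - {v})"
      have conf: "snd c \<in> rotor_configs G" "snd d \<in> rotor_configs G"
        using A(3)[OF c] A(3)[OF d] by (auto simp: unicycles_def rotor_states_def)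
      have "snd c u = snd d u" if u: "u \<in> verts G" for u
      proof (cases "u = v")
        case False
        then have "snd c u \<in> snd d ` (verts G - {v})"
          using eq u by blast
        then obtain w where w: "w \<in> verts G" "snd c u = snd d w"
          by blast
        moreover have "tail G (snd c u) = u" "tail G (snd d w) = w"
          using rotor_configs_out_arcs conf u w(1) by auto
        ultimately show ?thesis by simp
      qed (use A(2) c d in simp)
      then have "snd c = snd d"
        using conf unfolding rotor_configs_def by (auto intro: PiE_ext)
      then show "c = d"
        using A(1) c d by (simp add: prod_eq_iff)
    qed
    show "(\<lambda>c. snd c ` (verts G - {v})) ` A = {T. oriented_spanning_tree G v T}"
    proof
      show "(\<lambda>c. snd c ` (verts G - {v})) ` A \<subseteq> {T. oriented_spanning_tree G v T}"
        using A unicycle_tree by (metis (no_types, lifting) image_subsetI mem_Collect_eq prod.collapse)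
      show "{T. oriented_spanning_tree G v T} \<subseteq> (\<lambda>c. snd c ` (verts G - {v})) ` A"
      proof
        fix T assume "T \<in> {T. oriented_spanning_tree G v T}"
        then obtain \<rho> where "(v, \<rho>) \<in> unicycles" "\<rho> v = e" "\<rho> ` (verts G - {v}) = T"
          using tree_unicycle[of v T e] e by (auto simp: v_def out_arcs_def)
        then show "T \<in> (\<lambda>c. snd c ` (verts G - {v})) ` A"
          by (intro image_eqI[of _ _ "(v, \<rho>)"]) (auto simp: A_def)
      qed
    qed
  qed
  then show ?thesis
    unfolding tree_count_def A_def v_def by (rule bij_betw_same_card)
qed

lemma card_unicycles_rotor_in:
  assumes F: "F \<subseteq> arcs G"
  shows "card {c \<in> unicycles. snd c (fst c) \<in> F} = (\<Sum>e\<in>F. tree_count G (tail G e))"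
proof -
  have "{c \<in> unicycles. snd c (fst c) \<in> F} = (\<Union>e\<in>F. {c \<in> unicycles. snd c (fst c) = e})"
    by auto
  also have "card \<dots> = (\<Sum>e\<in>F. card {c \<in> unicycles. snd c (fst c) = e})"
    using finite_subset[OF F] finite_unicycles by (intro card_UN_disjoint) auto
  also have "\<dots> = (\<Sum>e\<in>F. tree_count G (tail G e))"
    using F card_unicycles_rotor by (intro sum.cong) auto
  finally show ?thesis .
qed

text \<open>
  The condition says that \<open>out_degree G v * m v\<close> is a stationary measure of the simple random walk
  on \<open>G\<close>.
\<close>

definition balanced :: "('a \<Rightarrow> nat) \<Rightarrow> bool" where
  "balanced m \<longleftrightarrow> (\<forall>v\<in>verts G. out_degree G v * m v = (\<Sum>e\<in>in_arcs G v. m (tail G e)))"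

text \<open>
  Both sides count the unicycles with chip at \<open>v\<close>: the left one by the rotor under the chip, the
  right one by the arc along which the chip has just arrived when \<open>advance\<close> is applied.
\<close>

lemma tree_count_balanced: "balanced (tree_count G)"
  unfolding balanced_def
proof
  fix v assume v: "v \<in> verts G"
  have "out_degree G v * tree_count G v = (\<Sum>e\<in>out_arcs G v. tree_count G (tail G e))"
    by (simp add: out_degree_def)
  also have "\<dots> = card {c \<in> unicycles. snd c (fst c) \<in> out_arcs G v}"
    by (rule card_unicycles_rotor_in[symmetric]) auto
  also have "{c \<in> unicycles. snd c (fst c) \<in> out_arcs G v} = {c \<in> unicycles. fst c = v}"
    using unicycle_rotor by (auto simp: out_arcs_def)
  also have "\<dots> = advance ` {c \<in> unicycles. fst (advance c) = v}"
  proof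
    show "{c \<in> unicycles. fst c = v} \<subseteq> advance ` {c \<in> unicycles. fst (advance c) = v}"
    proof
      fix d assume d: "d \<in> {c \<in> unicycles. fst c = v}"
      then obtain c where "c \<in> unicycles" "d = advance c"
        using bij_advance by (metis (no_types, lifting) bij_betw_imp_surj_on imageE mem_Collect_eq)
      with d show "d \<in> advance ` {c \<in> unicycles. fst (advance c) = v}"
        by blast
    qed
  qed (use advance_unicycle in blast)
  also have "card \<dots> = card {c \<in> unicycles. fst (advance c) = v}"
    using inj_advance by (intro card_image) (auto intro: inj_on_subset)
  also have "{c \<in> unicycles. fst (advance c) = v} = {c \<in> unicycles. snd c (fst c) \<in> in_arcs G v}"
    using unicycle_rotor by (auto simp: in_arcs_def advance_def follow_def split: prod.splits)
  also have "card \<dots> = (\<Sum>e\<in>in_arcs G v. tree_count G (tail G e))"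
    by (rule card_unicycles_rotor_in) auto
  finally show "out_degree G v * tree_count G v = (\<Sum>e\<in>in_arcs G v. tree_count G (tail G e))" .
qed

lemma card_unicycles: "card unicycles = (\<Sum>v\<in>verts G. out_degree G v * tree_count G v)"
proof -
  have "unicycles = {c \<in> unicycles. snd c (fst c) \<in> arcs G}"
    using unicycle_rotor by blast
  then have "card unicycles = (\<Sum>e\<in>arcs G. tree_count G (tail G e))"
    using card_unicycles_rotor_in[of "arcs G"] by simp
  also have "\<dots> = (\<Sum>v\<in>verts G. \<Sum>e\<in>out_arcs G v. tree_count G (tail G e))"
    unfolding out_arcs_def by (rule sum.group[symmetric]) auto
  also have "\<dots> = (\<Sum>v\<in>verts G. out_degree G v * tree_count G v)"
    by (simp add: out_degree_def)
  finally show ?thesis .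
qed

lemma tree_count_pos:
  assumes "c \<in> unicycles"
  shows "tree_count G (fst c) > 0"
proof -
  have "card {d \<in> unicycles. snd d (fst d) = snd c (fst c)} > 0"
    using assms finite_unicycles by (cases c) (auto simp: card_gt_0_iff)
  then show ?thesis
    using card_unicycles_rotor[OF unicycle_rotor(1)[OF assms]] unicycle_rotor(2)[OF assms] by simp
qed

section \<open>Firing counts along a trajectory\<close>

definition fired :: "'a \<times> ('a \<Rightarrow> 'b) \<Rightarrow> nat \<Rightarrow> 'a \<Rightarrow> nat" where
  "fired c n u = (\<Sum>i<n. of_bool (fst ((step ^^ i) c) = u))"

definition used :: "'a \<times> ('a \<Rightarrow> 'b) \<Rightarrow> nat \<Rightarrow> 'b \<Rightarrow> nat" where
  "used c n e = (\<Sum>i<n. of_bool (snd ((step ^^ Suc i) c) (fst ((step ^^ i) c)) = e))"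

lemma fired_simps [simp]:
  "fired c 0 u = 0"
  "fired c (Suc n) u = fired c n u + of_bool (fst ((step ^^ n) c) = u)"
  by (simp_all add: fired_def)

lemma step_sel:
  "fst (step c) = head G (snd (step c) (fst c))"
  "snd (step c) u = (if u = fst c then nxt (snd c u) else snd c u)"
  by (cases c; simp add: Let_def)+

lemma rotor_after: "snd ((step ^^ n) c) u = (nxt ^^ fired c n u) (snd c u)"
  by (induction n) (auto simp: step_sel simp del: rotor_step.simps)

text \<open>
  The arcs out of a vertex are used in cyclic order, starting after the initial rotor, however the
  firings of different vertices are interleaved.
\<close>

lemma used_eq_visits:
  assumes c: "c \<in> rotor_states G"
  shows "used c n e = visits nxt (snd c (tail G e)) e (fired c n (tail G e))"
proof (induction n)
  case 0
  show ?case by (simp add: used_def)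
next
  case (Suc n)
  define d where "d = (step ^^ n) c"
  have d: "d \<in> rotor_states G"
    using c funpow_step_state by (simp add: d_def)
  have "snd (step d) (fst d) = nxt (snd d (fst d))"
    by (simp add: step_sel)
  moreover have "snd (step d) (fst d) \<in> out_arcs G (fst d)"
    using rotor_configs_out_arcs[of "snd (step d)" "fst d"] step_state[OF d] d
    by (auto simp: rotor_states_def simp del: rotor_step.simps)
  ultimately have "(snd (step d) (fst d) = e)
      = (fst d = tail G e \<and> (nxt ^^ Suc (fired c n (tail G e))) (snd c (tail G e)) = e)"
    using rotor_after[of n c "tail G e"] by (auto simp: d_def)
  then show ?case
    using Suc by (auto simp: used_def d_def simp del: rotor_step.simps)
qed

text \<open>
  A visit of the chip to \<open>v\<close> either is the start of the walk or comes through an arc into \<open>v\<close>; and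
  a visit either is followed by a firing of \<open>v\<close> or is the end of the walk.
\<close>

lemma conservation:
  assumes c: "c \<in> rotor_states G"
  shows "fired c n v + of_bool (fst ((step ^^ n) c) = v)
    = of_bool (fst c = v) + (\<Sum>e\<in>in_arcs G v. used c n e)"
proof (induction n)
  case 0
  show ?case by (simp add: used_def)
next
  case (Suc n)
  define d where "d = (step ^^ n) c"
  define a where "a = snd (step d) (fst d)"
  have d: "d \<in> rotor_states G"
    using c funpow_step_state by (simp add: d_def)
  have "a \<in> arcs G"
    using rotor_configs_out_arcs[of "snd (step d)" "fst d"] step_state[OF d] d
    by (auto simp: a_def rotor_states_def)
  then have "of_bool (fst (step d) = v) = (of_bool (a \<in> in_arcs G v) :: nat)"
    by (simp add: in_arcs_def a_def step_sel(1))
  also have "\<dots> = (\<Sum>e\<in>in_arcs G v. of_bool (a = e))"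
    by (simp add: of_bool_def finite_in_arcs del: in_in_arcs_conv)
  finally have "of_bool (fst (step d) = v) = (\<Sum>e\<in>in_arcs G v. of_bool (a = e) :: nat)" .
  moreover have "used c (Suc n) e = used c n e + of_bool (a = e)" for e
    by (simp add: used_def a_def d_def)
  ultimately show ?case
    using Suc by (simp add: sum.distrib d_def del: rotor_step.simps)
qed

lemma sum_fired:
  assumes c: "c \<in> rotor_states G"
  shows "(\<Sum>u\<in>verts G. fired c n u) = n"
proof (induction n)
  case (Suc n)
  have "fst ((step ^^ n) c) \<in> verts G"
    using funpow_step_state[OF c, of n] by (auto simp: rotor_states_def)
  then show ?case
    using Suc by (simp add: sum.distrib of_bool_def)
qed simp

lemma fired_periods:
  assumes "(step ^^ p) c = c"
  shows "fired c (k * p) u = k * fired c p u"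
proof -
  have "fired c (p + n) u = fired c p u + fired c n u" for n
  proof (induction n)
    case (Suc n)
    have "(step ^^ (p + n)) c = (step ^^ n) c"
      using assms by (metis add.commute comp_apply funpow_add)
    then show ?case
      using Suc by simp
  qed simp
  then show ?thesis
    by (induction k) simp_all
qed

text \<open>
  Give each vertex \<open>u\<close> a budget of \<open>out_degree G u * m u\<close> firings, and stop when the chip first
  stands on a vertex \<open>w\<close> without budget left. Arcs out of \<open>u\<close> have then been used at most \<open>m u\<close>
  times each, so by balance the arcs into \<open>w\<close> account for at most its budget of visits; the chip has
  visited \<open>w\<close> once more than that, so \<open>w\<close> is the start. If all arcs into a vertex \<open>x\<close> are used to
  the full, this includes the initial rotor of any vertex \<open>u\<close> pointing to \<open>x\<close>. As the initial rotor
  is the last arc in a full turn, \<open>u\<close> has spent its whole budget, and again by balance the arcs into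
  \<open>u\<close> are used to the full. In a unicycle this backward propagation from \<open>w\<close> covers all vertices.
\<close>

lemma unicycle_return:
  fixes m :: "'a \<Rightarrow> nat"
  assumes c: "c \<in> unicycles" and bal: "balanced m"
  defines "N \<equiv> \<Sum>v\<in>verts G. out_degree G v * m v"
  shows "(step ^^ N) c = c"
    and "u \<in> verts G \<Longrightarrow> fired c N u = out_degree G u * m u"
proof -
  define B where "B u = out_degree G u * m u" for u
  define loc where "loc t = fst ((step ^^ t) c)" for t
  have cst: "c \<in> rotor_states G" and conf: "snd c \<in> rotor_configs G"
    and reach: "\<And>u. u \<in> verts G \<Longrightarrow> reaches (snd c) u (fst c)"
    using c by (auto simp: unicycles_def rotor_states_def)
  have bound: "fired c t u \<le> B u" if "\<And>s. s < t \<Longrightarrow> fired c s (loc s) < B (loc s)" for t u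
    using that
  proof (induction t)
    case (Suc t)
    then have "fired c t u \<le> B u" "fired c t (loc t) < B (loc t)"
      by simp_all
    then show ?case
      by (auto simp: loc_def)
  qed simp
  \<comment> \<open>Otherwise no budget would ever be exceeded, although the total number of firings grows.\<close>
  have "\<exists>t. \<not> fired c t (loc t) < B (loc t)"
  proof (rule ccontr)
    assume "\<not> ?thesis"
    then have "fired c (Suc N) u \<le> B u" for u
      using bound by blast
    then have "(\<Sum>u\<in>verts G. fired c (Suc N) u) \<le> N"
      unfolding N_def B_def by (intro sum_mono) blast
    then show False
      by (simp only: sum_fired[OF cst])
  qed
  then obtain t where t: "\<not> fired c t (loc t) < B (loc t)"
      "\<And>s. s < t \<Longrightarrow> fired c s (loc s) < B (loc s)"
    using exists_least_iff[of "\<lambda>t. \<not> fired c t (loc t) < B (loc t)"] by blast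
  have fired_le: "fired c t u \<le> B u" for u
    using bound t(2) .
  define w where "w = loc t"
  have w: "w \<in> verts G" "fired c t w = B w"
    using funpow_step_state[OF cst, of t] t(1) fired_le[of w]
    by (auto simp: w_def loc_def rotor_states_def)
  have used_le: "used c t e \<le> m (tail G e)" if e: "e \<in> arcs G" for e
  proof -
    have u: "tail G e \<in> verts G" "e \<in> out_arcs G (tail G e)"
      using e by auto
    show ?thesis
      unfolding used_eq_visits[OF cst]
      using fired_le[of "tail G e"]
      by (intro visits_le_turns[OF cyclic[OF u(1)] rotor_configs_out_arcs[OF conf u(1)] u(2)])
        (simp add: B_def out_degree_def)
  qed
  have cons: "fired c t v + of_bool (w = v) = of_bool (fst c = v) + (\<Sum>e\<in>in_arcs G v. used c t e)" for v
    using conservation[OF cst, of t v] by (simp add: w_def loc_def)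
  have "(\<Sum>e\<in>in_arcs G w. used c t e) \<le> (\<Sum>e\<in>in_arcs G w. m (tail G e))"
    by (intro sum_mono used_le) auto
  also have "\<dots> = B w"
    using bal w by (simp add: balanced_def B_def)
  finally have home: "fst c = w"
    using cons[of w] w by (cases "fst c = w") auto
  \<comment> \<open>Induction on the number of initial rotors between \<open>u\<close> and the start.\<close>
  have full: "fired c t u = B u" if u: "u \<in> verts G" for u
  proof -
    obtain n where "(follow (snd c) ^^ n) u = w"
      using reach[OF u] home by (auto simp: reaches_def)
    then show ?thesis
      using u
    proof (induction n arbitrary: u)
      case 0
      then show ?case
        using w by simp
    next
      case (Suc n)
      define e where "e = snd c u"
      define x where "x = head G e"
      have e: "e \<in> arcs G" "tail G e = u" "e \<in> out_arcs G u"
        using rotor_configs_out_arcs[OF conf Suc.prems(2)] by (auto simp: e_def)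
      have "(follow (snd c) ^^ n) x = w"
        using Suc.prems(1) by (simp only: funpow_Suc_right comp_apply x_def e_def follow_def[of _ u])
      moreover have x: "x \<in> verts G"
        using e by (auto simp: x_def)
      ultimately have "fired c t x = B x"
        by (rule Suc.IH)
      then have "(\<Sum>a\<in>in_arcs G x. used c t a) = (\<Sum>a\<in>in_arcs G x. m (tail G a))"
        using cons[of x] home bal x by (simp add: balanced_def B_def)
      then have "used c t e = m (tail G e)"
        using e used_le by (intro sum_mono_inv[of "used c t" "in_arcs G x"]) (auto simp: x_def)
      then have "visits nxt e e (fired c t u) = m u"
        using e by (simp add: used_eq_visits[OF cst] e_def)
      then show ?case
        using visits_own_full[OF cyclic[OF Suc.prems(2)] e(3)] fired_le[of u]
        by (simp add: B_def out_degree_def)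
    qed
  qed
  have "t = (\<Sum>u\<in>verts G. fired c t u)"
    using sum_fired[OF cst] by simp
  also have "\<dots> = N"
    unfolding N_def using full by (intro sum.cong) (simp_all add: B_def)
  finally have tN: "t = N" .
  then show "u \<in> verts G \<Longrightarrow> fired c N u = out_degree G u * m u"
    using full by (simp add: B_def)
  have "snd ((step ^^ N) c) \<in> rotor_configs G"
    using funpow_step_state[OF cst, of N] by (auto simp: rotor_states_def)
  moreover have "snd ((step ^^ N) c) u = snd c u" if u: "u \<in> verts G" for u
  proof -
    have "card (out_arcs G u) dvd fired c N u"
      using full[OF u] tN by (simp add: B_def out_degree_def)
    then show ?thesis
      using cyclic_on_funpow_card(3)[OF cyclic[OF u] rotor_configs_out_arcs[OF conf u]]
      by (simp add: rotor_after)
  qed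
  ultimately have "snd ((step ^^ N) c) = snd c"
    using conf unfolding rotor_configs_def by (auto intro: PiE_ext)
  moreover have "fst ((step ^^ N) c) = fst c"
    using home tN by (simp add: w_def loc_def)
  ultimately show "(step ^^ N) c = c"
    by (simp add: prod_eq_iff)
qed

section \<open>Recurrent states are unicycles\<close>

lemma reaches_step:
  assumes "reaches (snd c) u (fst c)"
  shows "reaches (snd (step c)) u (fst (step c))"
  using assms unfolding step_eq
  by (cases c) (auto simp: rotate_def advance_def intro: reaches_trans reaches_upd reaches_follow)

text \<open>
  The rotor of a visited vertex points to where the chip went at its last departure from there; this
  persists because a step keeps every vertex that leads to the chip in that position.
\<close>

lemma visited_reaches:
  assumes "i \<le> n"
  shows "reaches (snd ((step ^^ n) c)) (fst ((step ^^ i) c)) (fst ((step ^^ n) c))"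
  using assms by (induction n rule: dec_induct) (simp_all add: reaches_step del: rotor_step.simps)

lemma unicycle_recurrent:
  assumes c: "c \<in> unicycles"
  shows "c \<in> recurrent_states G nxt"
proof -
  define N where "N = (\<Sum>v\<in>verts G. out_degree G v * tree_count G v)"
  have "N > 0"
    using c card_unicycles finite_unicycles card_gt_0_iff by (metis N_def empty_iff)
  moreover have "(step ^^ N) c = c"
    unfolding N_def using unicycle_return(1)[OF c tree_count_balanced] .
  ultimately show ?thesis
    using c unicycles_subset by (auto simp: recurrent_states_def)
qed

text \<open>
  A vertex on a periodic walk is visited infinitely often, hence uses all its outgoing arcs; so the
  set of visited vertices is closed under successors.
\<close>

lemma recurrent_unicycle:
  assumes conn: "strongly_connected G" and c: "c \<in> recurrent_states G nxt"
  shows "c \<in> unicycles"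
proof -
  obtain n where cst: "c \<in> rotor_states G" and n: "n > 0" "(step ^^ n) c = c"
    using c by (auto simp: recurrent_states_def)
  have conf: "snd c \<in> rotor_configs G" and start: "fst c \<in> verts G"
    using cst by (auto simp: rotor_states_def)
  define visited where "visited u \<longleftrightarrow> (\<exists>i<n. fst ((step ^^ i) c) = u)" for u
  have visitedI: "visited (fst ((step ^^ i) c))" for i
    unfolding visited_def using funpow_mod_eq[OF n(2), of i] n(1)
    by (metis mod_less_divisor)
  have spread: "visited (head G e)" if e: "e \<in> arcs G" and vis: "visited (tail G e)" for e
  proof -
    define u where "u = tail G e"
    have u: "u \<in> verts G" "e \<in> out_arcs G u"
      using e by (auto simp: u_def)
    obtain i where i: "i < n" "fst ((step ^^ i) c) = u"
      using vis by (auto simp: visited_def u_def)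
    have "of_bool (fst ((step ^^ i) c) = u) \<le> fired c n u"
      unfolding fired_def using i by (intro member_le_sum) auto
    then have "fired c n u \<ge> 1"
      using i by simp
    \<comment> \<open>After \<open>out_degree G u\<close> periods the rotor at \<open>u\<close> has made at least one full turn.\<close>
    then have "fired c (out_degree G u * n) u \<ge> out_degree G u"
      by (simp add: fired_periods[OF n(2)])
    then have "visits nxt (snd c u) e (fired c (out_degree G u * n) u) \<ge> 1"
      using visits_mono[of "out_degree G u * 1"]
        visits_full_turns[OF cyclic[OF u(1)] rotor_configs_out_arcs[OF conf u(1)] u(2), of 1]
      by (metis mult.right_neutral out_degree_def)
    then have "used c (out_degree G u * n) e \<noteq> 0"
      by (simp add: used_eq_visits[OF cst] u_def)
    then obtain j where "snd ((step ^^ Suc j) c) (fst ((step ^^ j) c)) = e"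
      by (auto simp: used_def simp del: funpow.simps elim!: sum.not_neutral_contains_not_neutral)
    then have "fst ((step ^^ Suc j) c) = head G e"
      using step_sel(1)[of "(step ^^ j) c"] by simp
    then show ?thesis
      using visitedI by metis
  qed
  have "visited u" if u: "u \<in> verts G" for u
  proof -
    have "fst c \<rightarrow>\<^sup>* u"
      using conn u start by (auto simp: strongly_connected_def)
    then show ?thesis
    proof (induction rule: reachable_induct)
      case base
      show ?case
        using visitedI[of 0] by simp
    next
      case (step x y)
      then show ?case
        using spread by (auto simp: arcs_ends_conv)
    qed
  qed
  then have "reaches (snd c) u (fst c)" if "u \<in> verts G" for u
    using that visited_reaches[of _ n c] n(2) by (metis less_imp_le visited_def)
  then show ?thesis
    using cst by (auto simp: unicycles_def)
qed

section \<open>The common orbit size\<close>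

text \<open>
  The return time given by \<open>tree_count / M\<close> is \<open>q\<close> periods. Since each period makes every rotor turn
  around completely, \<open>q\<close> divides all quotients \<open>tree_count v / M\<close>, which forces \<open>q = 1\<close>.
\<close>

lemma card_rotor_orbit:
  assumes c: "c \<in> unicycles"
  defines "M \<equiv> GCD v\<in>verts G. tree_count G v"
  shows "M * card (rotor_orbit G nxt c) = card unicycles"
proof -
  have M: "M dvd tree_count G v" if "v \<in> verts G" for v
    using that by (simp add: M_def)
  have cst: "c \<in> rotor_states G" and conf: "snd c \<in> rotor_configs G" and start: "fst c \<in> verts G"
    using c by (auto simp: unicycles_def rotor_states_def)
  have M_pos: "M > 0"
    using M[OF start] tree_count_pos[OF c] by (metis dvd_0_left_iff gr0I less_irrefl)
  define m where "m v = tree_count G v div M" for v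
  have Mm: "M * m v = tree_count G v" if "v \<in> verts G" for v
    using M[OF that] by (simp add: m_def)
  have bal: "balanced m"
    unfolding balanced_def
  proof
    fix v assume v: "v \<in> verts G"
    have "M * (out_degree G v * m v) = out_degree G v * tree_count G v"
      using Mm[OF v] by (simp add: mult.left_commute)
    also have "\<dots> = (\<Sum>e\<in>in_arcs G v. tree_count G (tail G e))"
      using tree_count_balanced v by (simp add: balanced_def)
    also have "\<dots> = (\<Sum>e\<in>in_arcs G v. M * m (tail G e))"
      by (intro sum.cong) (auto simp: Mm)
    also have "\<dots> = M * (\<Sum>e\<in>in_arcs G v. m (tail G e))"
      by (simp add: sum_distrib_left)
    finally show "out_degree G v * m v = (\<Sum>e\<in>in_arcs G v. m (tail G e))"
      using M_pos by simp
  qed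
  define N where "N = (\<Sum>v\<in>verts G. out_degree G v * m v)"
  have ret: "(step ^^ N) c = c" and fired_N: "\<And>u. u \<in> verts G \<Longrightarrow> fired c N u = out_degree G u * m u"
    unfolding N_def using unicycle_return[OF c bal] by blast+
  define p where "p = card (rotor_orbit G nxt c)"
  have self: "c \<in> orbit step c"
    using unicycle_recurrent[OF c] by (auto simp: recurrent_states_def orbit_altdef intro: sym)
  then have cyc: "cyclic_on step (orbit step c)"
    by (auto simp: cyclic_on_def)
  have p: "(step ^^ p) c = c"
    unfolding p_def rotor_orbit_def by (rule cyclic_on_funpow_card(1)[OF cyc self])
  have "p dvd N"
    using cyclic_on_funpow_card(3)[OF cyc self, of N] ret by (simp add: p_def rotor_orbit_def)
  then obtain q where q: "N = q * p"
    by (metis dvdE mult.commute)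
  have "q * M dvd tree_count G v" if v: "v \<in> verts G" for v
  proof -
    have "(nxt ^^ fired c p v) (snd c v) = snd c v"
      using rotor_after[of p c v] p by simp
    then have "out_degree G v dvd fired c p v"
      using cyclic_on_funpow_card(3)[OF cyclic[OF v] rotor_configs_out_arcs[OF conf v]]
      by (simp add: out_degree_def)
    then obtain k where "fired c p v = out_degree G v * k" ..
    then have "out_degree G v * m v = out_degree G v * (q * k)"
      using fired_N[OF v] fired_periods[OF p, of q v] q by (metis mult.left_commute)
    moreover have "out_degree G v > 0"
      using no_sink[OF v] by (simp add: out_degree_def card_gt_0_iff finite_out_arcs)
    ultimately have "m v = q * k"
      by simp
    then show ?thesis
      using Mm[OF v] by (metis dvd_triv_left mult.assoc mult.commute)
  qed
  then have "q * M dvd M"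
    unfolding M_def by (intro Gcd_greatest) auto
  then have "q = 1"
    using M_pos by (simp add: dvd_mult_cancel2)
  then have "M * p = (\<Sum>v\<in>verts G. M * (out_degree G v * m v))"
    using q by (simp add: N_def flip: sum_distrib_left)
  also have "\<dots> = card unicycles"
    unfolding card_unicycles by (intro sum.cong) (simp_all add: Mm[symmetric] mult.left_commute)
  finally show ?thesis
    by (simp add: p_def)
qed

lemma rotor_orbit_unicycles:
  assumes "c \<in> unicycles"
  shows "c \<in> rotor_orbit G nxt c" "rotor_orbit G nxt c \<subseteq> unicycles"
proof -
  show "c \<in> rotor_orbit G nxt c"
    using unicycle_recurrent[OF assms]
    by (auto simp: recurrent_states_def rotor_orbit_def orbit_altdef intro: sym)
  have "d \<in> unicycles" if "d \<in> orbit step c" for d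
    using that
    by induction (use assms in \<open>simp_all add: step_eq rotate_unicycle advance_unicycle\<close>)
  then show "rotor_orbit G nxt c \<subseteq> unicycles"
    by (auto simp: rotor_orbit_def)
qed

lemma rotor_orbit_eq:
  assumes "c \<in> unicycles" "d \<in> rotor_orbit G nxt c"
  shows "rotor_orbit G nxt d = rotor_orbit G nxt c"
proof -
  have "cyclic_on step (rotor_orbit G nxt c)"
    using rotor_orbit_unicycles(1)[OF assms(1)] by (auto simp: cyclic_on_def rotor_orbit_def)
  then show ?thesis
    using orbit_cyclic_eq3 assms(2) by (metis rotor_orbit_def)
qed

text \<open>
  If there is no unicycle, all tree counts vanish, and so does their greatest common divisor.
\<close>

lemma card_rotor_orbits:
  "card (rotor_orbit G nxt ` unicycles) = (GCD v\<in>verts G. tree_count G v)"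
proof (cases "unicycles = {}")
  case True
  then have "(\<Sum>v\<in>verts G. out_degree G v * tree_count G v) = 0"
    using card_unicycles by simp
  then have "tree_count G v = 0" if "v \<in> verts G" for v
    using that no_sink[OF that] by (auto simp: out_degree_def finite_out_arcs)
  then have "(GCD v\<in>verts G. tree_count G v) = 0"
    by (auto simp: Gcd_0_iff)
  then show ?thesis
    using True by simp
next
  case False
  define M where "M = (GCD v\<in>verts G. tree_count G v)"
  obtain c where c: "c \<in> unicycles"
    using False by blast
  define k where "k = card (rotor_orbit G nxt c)"
  have Mk: "M * k = card unicycles"
    using card_rotor_orbit[OF c] by (simp add: M_def k_def)
  then have pos: "M > 0" "k > 0"
    using finite_unicycles False by (metis card_gt_0_iff mult_is_0 neq0_conv)+
  have "\<Union> (rotor_orbit G nxt ` unicycles) = unicycles"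
    using rotor_orbit_unicycles by blast
  moreover have "card C = k" if "C \<in> rotor_orbit G nxt ` unicycles" for C
  proof -
    obtain d where "d \<in> unicycles" "C = rotor_orbit G nxt d"
      using \<open>C \<in> _\<close> by blast
    then have "M * card C = M * k"
      using card_rotor_orbit Mk by (simp add: M_def)
    then show ?thesis
      using pos by simp
  qed
  moreover have "C \<inter> D = {}"
    if "C \<in> rotor_orbit G nxt ` unicycles" "D \<in> rotor_orbit G nxt ` unicycles" "C \<noteq> D" for C D
  proof (rule ccontr)
    assume "C \<inter> D \<noteq> {}"
    then obtain x where "x \<in> C" "x \<in> D"
      by blast
    moreover have "rotor_orbit G nxt x = E"
      if E: "E \<in> rotor_orbit G nxt ` unicycles" "x \<in> E" for E
    proof -
      obtain d where "d \<in> unicycles" "E = rotor_orbit G nxt d"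
        using E(1) by (rule imageE)
      then show ?thesis
        using rotor_orbit_eq[of d x] E(2) by simp
    qed
    ultimately show False
      using that by metis
  qed
  ultimately have "k * card (rotor_orbit G nxt ` unicycles) = card unicycles"
    using card_partition[of "rotor_orbit G nxt ` unicycles" k] finite_unicycles by simp
  then show ?thesis
    using Mk pos by (metis M_def mult.commute mult_left_cancel neq0_conv)
qed

end

theorem theorem1:
  fixes G :: "('a, 'b) pre_digraph" and nxt :: "'b \<Rightarrow> 'b" and M :: nat
  assumes "fin_digraph G"
    and "strongly_connected G"
    and "arcs G \<noteq> {}"
    and "cyclic_orderings G nxt"
  defines "M \<equiv> (GCD v\<in>verts G. tree_count G v)"
  shows "(\<forall>c \<in> recurrent_states G nxt.
            real (card (rotor_orbit G nxt c)) =
              1 / real M * (\<Sum>v\<in>verts G. real (out_degree G v) * real (tree_count G v)))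
         \<and> card (rotor_orbit G nxt ` recurrent_states G nxt) = M"
proof -
  interpret fin_digraph G by fact
  have no_sink: "out_arcs G v \<noteq> {}" if v: "v \<in> verts G" for v
  proof -
    obtain e where e: "e \<in> arcs G"
      using assms(3) by blast
    then have "v \<rightarrow>\<^sup>*\<^bsub>G\<^esub> tail G e"
      using assms(2) v by (auto simp: strongly_connected_def)
    then show ?thesis
    proof (cases rule: converse_reachable_cases)
      case base
      then show ?thesis
        using e by auto
    next
      case (step w)
      then show ?thesis
        by (auto simp: arcs_ends_conv)
    qed
  qed
  interpret rotor_digraph G nxt
    using no_sink assms(4) by unfold_locales (simp add: cyclic_orderings_def)
  have rec: "recurrent_states G nxt = unicycles"
    using unicycle_recurrent recurrent_unicycle[OF assms(2)] by blast
  have "real (card (rotor_orbit G nxt c))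
      = 1 / real M * (\<Sum>v\<in>verts G. real (out_degree G v) * real (tree_count G v))"
    if c: "c \<in> unicycles" for c
  proof -
    have eq: "M * card (rotor_orbit G nxt c) = (\<Sum>v\<in>verts G. out_degree G v * tree_count G v)"
      using card_rotor_orbit[OF c] card_unicycles by (simp add: M_def)
    then have "real M * real (card (rotor_orbit G nxt c))
        = (\<Sum>v\<in>verts G. real (out_degree G v) * real (tree_count G v))"
      by (metis (no_types, lifting) of_nat_mult of_nat_sum sum.cong)
    moreover have "M > 0"
      using eq c card_unicycles finite_unicycles
      by (metis card_gt_0_iff empty_iff mult_is_0 neq0_conv)
    ultimately show ?thesis
      by (simp add: field_simps)
  qed
  then show ?thesis
    using card_rotor_orbits by (simp add: rec M_def)
qed

end
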